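(* Let $n\geq 1$ and let $K$ be a minimal simplicial complex generating $\mathsf{Mon}_n$. Then every maximal simplex of $K$ is an interval of $I_n$.
   Context: For finite sets $A,I$, a language is a subset $L\subseteq A^I$. For finite sets $B,J$ and a function $f:B^J\to A^I$, the input window $\mathcal{W}_f(i)\subseteq J$ of $i\in I$ is the smallest $W\subseteq J$ such that for all $x,y\in B^J$ agreeing on $W$, $f(x)_i=f(y)_i$. The communication complex $K_f$ is the simplicial complex on vertex set $I$ whose simplices are the sets $S\subseteq I$ with $\bigcap_{i\in S}\mathcal{W}_f(i)\neq\emptyset$. A simplicial complex $K$ on $I$ generates $L$ if there exist finite sets $B,J$ and $f:B^J\to A^I$ with $f(B^J)=L$ and $K_f\subseteq K$; $K$ is minimal generating $L$ if it generates $L$ and no complex properly contained in $K$ generates $L$. $\mathsf{Mon}_n\subseteq\{0,1\}^n$ is the set of binary strings $x_0\ldots x_{n-1}$ that are non-decreasing or non-increasing. Positions $I_n=\{0,\ldots,n-1\}$ are identified with $\mathbb{Z}/n\mathbb{Z}$. For $a,b\in\mathbb{Z}$, the interval $[\![a,b]\!]=\{c\bmod n: c\in\mathbb{Z},\ a\leq c\leq b'\}$ where $b'$ is the representative of $b$ modulo $n$ with $a\leq b'<a+n$. An interval is any set of the form $[\![a,b]\!]$. *)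

theory Defs
  imports Main "HOL-Library.FuncSet" "HOL-Number_Theory.Cong"
begin

text \<open>
  For sets \<open>X\<close> and \<open>Y\<close>, the set of functions \<open>Y\<^sup>X\<close> is the extensional function space
  \<^term>\<open>X \<rightarrow>\<^sub>E Y\<close>.
\<close>

definition input_window ::
  "'b set \<Rightarrow> 'j set \<Rightarrow> (('j \<Rightarrow> 'b) \<Rightarrow> 'i \<Rightarrow> 'a) \<Rightarrow> 'i \<Rightarrow> 'j set" where
  "input_window B J f i =
     (LEAST W. W \<subseteq> J \<and>
        (\<forall>x \<in> J \<rightarrow>\<^sub>E B. \<forall>y \<in> J \<rightarrow>\<^sub>E B. (\<forall>j\<in>W. x j = y j) \<longrightarrow> f x i = f y i))"

text \<open>
  The least set exists because \<open>J\<close> is finite: the sets of inputs that determine the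
  value at \<open>i\<close> are closed under intersection.
\<close>

lemma input_window_is_least:
  fixes B :: "'b set" and J :: "'j set" and f :: "('j \<Rightarrow> 'b) \<Rightarrow> 'i \<Rightarrow> 'a" and i :: 'i
  assumes "finite J"
  defines "det \<equiv> \<lambda>W. W \<subseteq> J \<and>
        (\<forall>x \<in> J \<rightarrow>\<^sub>E B. \<forall>y \<in> J \<rightarrow>\<^sub>E B. (\<forall>j\<in>W. x j = y j) \<longrightarrow> f x i = f y i)"
  shows "det (input_window B J f i)"
    and "det W \<Longrightarrow> input_window B J f i \<subseteq> W"
proof -
  have "det J"
    unfolding det_def
  proof (intro conjI ballI impI)
    fix x y assume "x \<in> J \<rightarrow>\<^sub>E B" "y \<in> J \<rightarrow>\<^sub>E B" "\<forall>j\<in>J. x j = y j"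
    then have "x = y" by (intro PiE_ext) auto
    then show "f x i = f y i" by simp
  qed simp
  have int: "det (V \<inter> W)" if V: "det V" and W: "det W" for V W
    unfolding det_def
  proof (intro conjI ballI impI)
    show "V \<inter> W \<subseteq> J" using V unfolding det_def by blast
  next
    fix x y assume x: "x \<in> J \<rightarrow>\<^sub>E B" and y: "y \<in> J \<rightarrow>\<^sub>E B" and e: "\<forall>j\<in>V \<inter> W. x j = y j"
    define z where "z = (\<lambda>j. if j \<in> V then x j else y j)"
    have "V \<subseteq> J" using V unfolding det_def by blast
    then have z: "z \<in> J \<rightarrow>\<^sub>E B"
      using x y unfolding z_def PiE_iff extensional_def by auto
    have "\<forall>j\<in>V. x j = z j" by (simp add: z_def)
    then have "f x i = f z i"
      using V x z unfolding det_def by blast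
    moreover have "\<forall>j\<in>W. z j = y j" using e by (simp add: z_def)
    then have "f z i = f y i"
      using W y z unfolding det_def by blast
    ultimately show "f x i = f y i" by simp
  qed
  have "{W. det W} \<subseteq> Pow J"
    unfolding det_def by blast
  then have fin: "finite {W. det W}"
    using assms(1) finite_subset by blast
  have "F \<subseteq> {W. det W} \<longrightarrow> det (\<Inter>F)" if "finite F" "F \<noteq> {}" for F
    using that
  proof (induction F rule: finite_ne_induct)
    case (singleton V)
    then show ?case by simp
  next
    case (insert V F)
    then show ?case using int[of V "\<Inter>F"] by simp
  qed
  then have inter: "det (\<Inter>{W. det W})"
    using fin \<open>det J\<close> by blast
  have "input_window B J f i = (LEAST W. det W)"
    unfolding input_window_def det_def ..
  also have "\<dots> = \<Inter>{W. det W}"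
    using inter by (rule Least_equality) (simp add: Inter_lower)
  finally have eq: "input_window B J f i = \<Inter>{W. det W}" .
  show "det (input_window B J f i)" unfolding eq by (rule inter)
  show "det W \<Longrightarrow> input_window B J f i \<subseteq> W" unfolding eq by (rule Inter_lower) simp
qed

text \<open>
  A complex on \<open>I\<close> is a family of subsets of \<open>I\<close> closed under taking subsets.
  Singletons are not required to belong to it: \<open>{i}\<close> is missing from a communication
  complex as soon as the coordinate \<open>i\<close> of \<open>f\<close> is constant.
\<close>

definition simplicial_complex_on :: "'i set \<Rightarrow> 'i set set \<Rightarrow> bool" where
  "simplicial_complex_on I K \<longleftrightarrow>
     (\<forall>S\<in>K. S \<subseteq> I) \<and> (\<forall>S\<in>K. \<forall>T. T \<subseteq> S \<longrightarrow> T \<in> K)"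

definition maximal_simplex :: "'i set set \<Rightarrow> 'i set \<Rightarrow> bool" where
  "maximal_simplex K S \<longleftrightarrow> S \<in> K \<and> (\<forall>T\<in>K. S \<subseteq> T \<longrightarrow> T = S)"

text \<open>
  Intersections are taken inside \<open>J\<close>, so that the intersection indexed by the empty set
  is \<open>J\<close>.
\<close>

definition communication_complex ::
  "'b set \<Rightarrow> 'j set \<Rightarrow> 'i set \<Rightarrow> (('j \<Rightarrow> 'b) \<Rightarrow> 'i \<Rightarrow> 'a) \<Rightarrow> 'i set set" where
  "communication_complex B J I f =
     {S. S \<subseteq> I \<and> J \<inter> (\<Inter>i\<in>S. input_window B J f i) \<noteq> {}}"

lemma simplicial_complex_on_communication_complex:
  "simplicial_complex_on I (communication_complex B J I f)"
  unfolding simplicial_complex_on_def communication_complex_def by blast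

text \<open>
  The finite sets \<open>B\<close> and \<open>J\<close> range over finite sets of natural numbers. Since only their
  cardinality matters, this covers all finite sets.
\<close>

definition generates ::
  "'a set \<Rightarrow> 'i set \<Rightarrow> 'i set set \<Rightarrow> ('i \<Rightarrow> 'a) set \<Rightarrow> bool" where
  "generates A I K L \<longleftrightarrow>
     (\<exists>(B :: nat set) (J :: nat set) f.
        finite B \<and> finite J \<and> f \<in> (J \<rightarrow>\<^sub>E B) \<rightarrow> (I \<rightarrow>\<^sub>E A) \<and>
        f ` (J \<rightarrow>\<^sub>E B) = L \<and> communication_complex B J I f \<subseteq> K)"

definition minimal_generating ::
  "'a set \<Rightarrow> 'i set \<Rightarrow> 'i set set \<Rightarrow> ('i \<Rightarrow> 'a) set \<Rightarrow> bool" where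
  "minimal_generating A I K L \<longleftrightarrow>
     simplicial_complex_on I K \<and> generates A I K L \<and>
     (\<forall>K'. simplicial_complex_on I K' \<and> K' \<subset> K \<longrightarrow> \<not> generates A I K' L)"

definition Mon :: "nat \<Rightarrow> (nat \<Rightarrow> nat) set" where
  "Mon n = {x \<in> {..<n} \<rightarrow>\<^sub>E {0, 1}. mono_on {..<n} x \<or> antimono_on {..<n} x}"

text \<open>
  The bound variable \<open>b'\<close> is the unique representative of \<open>b\<close> modulo \<open>n\<close> in \<open>[a, a + n)\<close>;
  residue classes modulo \<open>n\<close> are represented by \<open>0, \<dots>, n - 1\<close>.
\<close>

definition cyclic_interval :: "nat \<Rightarrow> int \<Rightarrow> int \<Rightarrow> nat set" where
  "cyclic_interval n a b =
     {nat (c mod int n) | c b'. [b' = b] (mod int n) \<and> a \<le> b' \<and> b' < a + int n \<and>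
                                a \<le> c \<and> c \<le> b'}"

definition is_interval_of :: "nat \<Rightarrow> nat set \<Rightarrow> bool" where
  "is_interval_of n S \<longleftrightarrow> (\<exists>a b. S = cyclic_interval n a b)"

end

theory Submission
  imports Defs
begin

text \<open>
  A maximal simplex \<open>S\<close> that is not an interval is separated by two positions \<open>p < q\<close> outside
  \<open>S\<close>: it has elements both strictly between them and beyond them. Two monotone strings that
  agree at \<open>p\<close> and \<open>q\<close> agree either between \<open>p\<close> and \<open>q\<close> or outside of this range, so taking the
  values of one between \<open>p\<close> and \<open>q\<close> and those of the other elsewhere gives back one of the two.
  Hence every input cell that is read exactly by the positions in \<open>S\<close> can be duplicated, one copy
  being read by the positions between \<open>p\<close> and \<open>q\<close> and the other copy by the other ones. The new
  function still generates the language, but no longer needs the simplex \<open>S\<close>.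
\<close>

section \<open>Input windows as least determining sets of cells\<close>

lemma input_window_subset:
  assumes "finite J"
  shows "input_window B J f i \<subseteq> J"
  by (rule conjunct1[OF input_window_is_least(1)[OF assms]])

lemma input_window_eqI:
  assumes "finite J" "x \<in> J \<rightarrow>\<^sub>E B" "y \<in> J \<rightarrow>\<^sub>E B"
    and "\<And>j. j \<in> input_window B J f i \<Longrightarrow> x j = y j"
  shows "f x i = f y i"
  using bspec[OF bspec[OF conjunct2[OF input_window_is_least(1)[OF assms(1), of B f i]] assms(2)]
      assms(3)] assms(4)
  by simp

lemma input_window_least:
  assumes "finite J" "W \<subseteq> J"
    and "\<And>x y. \<lbrakk>x \<in> J \<rightarrow>\<^sub>E B; y \<in> J \<rightarrow>\<^sub>E B; \<And>j. j \<in> W \<Longrightarrow> x j = y j\<rbrakk> \<Longrightarrow> f x i = f y i"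
  shows "input_window B J f i \<subseteq> W"
proof (rule input_window_is_least(2)[OF assms(1)], intro conjI ballI impI)
  fix x y assume "x \<in> J \<rightarrow>\<^sub>E B" "y \<in> J \<rightarrow>\<^sub>E B" "\<forall>j\<in>W. x j = y j"
  then show "f x i = f y i" by (intro assms(3)) simp_all
qed (rule assms(2))

section \<open>Deleting a maximal simplex from a generating complex\<close>

lemma simplicial_complex_on_remove_maximal:
  assumes "simplicial_complex_on I K" "maximal_simplex K S"
  shows "simplicial_complex_on I (K - {S})"
  unfolding simplicial_complex_on_def
proof (intro conjI ballI allI impI)
  fix T assume T: "T \<in> K - {S}"
  show "T \<subseteq> I" using assms(1) T by (simp add: simplicial_complex_on_def)
  fix U assume "U \<subseteq> T"
  \<comment> \<open>\<open>U = S\<close> would make \<open>S\<close> a face of \<open>T\<close>,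
    hence equal to \<open>T\<close> by maximality.\<close>
  then show "U \<in> K - {S}"
    using assms T unfolding simplicial_complex_on_def maximal_simplex_def
    by (metis Diff_iff singletonD)
qed

text \<open>The cell duplication with an arbitrary set \<open>C\<close> as one side.
  \<open>mix\<close> keeps the new outputs in \<open>L\<close>; \<open>meets\<close> and
  \<open>not_sub\<close> say that \<open>S\<close> has positions on both sides of \<open>C\<close>,
  so no copy is read by all of \<open>S\<close>; maximality ensures that only cells read exactly by
  \<open>S\<close> could produce the simplex \<open>S\<close>.\<close>

lemma generates_remove_maximal:
  fixes K :: "'i set set"
  assumes K: "simplicial_complex_on I K" and gen: "generates A I K L"
    and max: "maximal_simplex K S"
    and meets: "S \<inter> C \<noteq> {}" and not_sub: "\<not> S \<subseteq> C"
    and mix: "\<And>u v. \<lbrakk>u \<in> L; v \<in> L; \<And>i. i \<in> I - S \<Longrightarrow> u i = v i\<rbrakk> \<Longrightarrow> override_on v u C \<in> L"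
  shows "generates A I (K - {S}) L"
proof -
  obtain B J :: "nat set" and f where fin: "finite B" "finite J"
    and f: "f \<in> (J \<rightarrow>\<^sub>E B) \<rightarrow> (I \<rightarrow>\<^sub>E A)" and img: "f ` (J \<rightarrow>\<^sub>E B) = L"
    and sub: "communication_complex B J I f \<subseteq> K"
    using gen unfolding generates_def by blast
  define W where "W = input_window B J f"
  \<comment> \<open>\<open>V j\<close> is the set of readers of cell \<open>j\<close>, and
    \<open>JS\<close> collects the cells to be duplicated. Cell \<open>j\<close> becomes
    \<open>2 * j\<close>, and its second copy, present only for \<open>j\<close> in
    \<open>JS\<close>, is \<open>2 * j + 1\<close>. An input on \<open>J'\<close> thus encodes two
    inputs on \<open>J\<close> that can differ only on \<open>JS\<close>; \<open>g\<close> uses the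
    first on \<open>C\<close> and the second elsewhere.\<close>
  define V where "V j = {i \<in> I. j \<in> W i}" for j
  define JS where "JS = {j \<in> J. V j = S}"
  define J' where "J' = (\<lambda>j. 2 * j) ` J \<union> (\<lambda>j. 2 * j + 1) ` JS"
  define fst_copy where "fst_copy x = (\<lambda>j\<in>J. x (2 * j))" for x :: "nat \<Rightarrow> nat"
  define snd_copy where "snd_copy x = (\<lambda>j\<in>J. if j \<in> JS then x (2 * j + 1) else x (2 * j))"
    for x :: "nat \<Rightarrow> nat"
  define g where "g x = override_on (f (snd_copy x)) (f (fst_copy x)) C" for x
  have W_sub: "W i \<subseteq> J" for i
    unfolding W_def by (rule input_window_subset[OF fin(2)])
  have V_in: "V j \<in> K" if "j \<in> J" for j
  proof -
    have "V j \<in> communication_complex B J I f"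
      using that by (auto simp: communication_complex_def V_def W_def)
    then show ?thesis using sub by blast
  qed
  have copies: "fst_copy x \<in> J \<rightarrow>\<^sub>E B" "snd_copy x \<in> J \<rightarrow>\<^sub>E B" if "x \<in> J' \<rightarrow>\<^sub>E B" for x
    using that unfolding fst_copy_def snd_copy_def J'_def by (auto simp: PiE_iff)
  have fin': "finite J'"
    using fin(2) unfolding J'_def JS_def by simp
  have g_in: "g x \<in> L" if x: "x \<in> J' \<rightarrow>\<^sub>E B" for x
    unfolding g_def
  proof (rule mix)
    show "f (fst_copy x) \<in> L" "f (snd_copy x) \<in> L"
      using img copies[OF x] by blast+
    fix i assume i: "i \<in> I - S"
    \<comment> \<open>A position outside \<open>S\<close> reads no cell of \<open>JS\<close>, so it
      cannot tell the two decoded inputs apart.\<close>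
    show "f (fst_copy x) i = f (snd_copy x) i"
    proof (rule input_window_eqI[OF fin(2) copies[OF x]])
      fix j assume "j \<in> input_window B J f i"
      then have "j \<in> J" "j \<notin> JS"
        using i W_sub unfolding W_def[symmetric] JS_def V_def by blast+
      then show "fst_copy x j = snd_copy x j"
        by (simp add: fst_copy_def snd_copy_def)
    qed
  qed
  have g_img: "g ` (J' \<rightarrow>\<^sub>E B) = L"
  proof
    show "g ` (J' \<rightarrow>\<^sub>E B) \<subseteq> L" using g_in by blast
    show "L \<subseteq> g ` (J' \<rightarrow>\<^sub>E B)"
    proof
      fix w assume "w \<in> L"
      then obtain x where x: "x \<in> J \<rightarrow>\<^sub>E B" "w = f x" using img by blast
      \<comment> \<open>Both copies of a cell receive the same value, so both decoded inputs are
        \<open>x\<close> and \<open>g\<close> returns \<open>f x\<close>.\<close>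
      define y where "y = (\<lambda>k\<in>J'. x (k div 2))"
      have y: "y \<in> J' \<rightarrow>\<^sub>E B"
        unfolding y_def
      proof (rule restrict_PiE_iff[THEN iffD2], rule ballI)
        fix k assume "k \<in> J'"
        then have "k div 2 \<in> J" unfolding J'_def JS_def by auto
        then show "x (k div 2) \<in> B" using x(1) by (rule PiE_mem[rotated])
      qed
      have "y (2 * j) = x j" if "j \<in> J" for j
        using that by (simp add: y_def J'_def)
      moreover have "y (2 * j + 1) = x j" if "j \<in> JS" for j
        using that by (simp add: y_def J'_def)
      ultimately have "fst_copy y j = x j" "snd_copy y j = x j" for j
        using PiE_arb[OF x(1)] by (simp_all add: fst_copy_def snd_copy_def)
      then have "fst_copy y = x" "snd_copy y = x" by blast+
      then have "g y = w" by (simp add: g_def x(2) override_on_def)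
      then show "w \<in> g ` (J' \<rightarrow>\<^sub>E B)" using y by blast
    qed
  qed
  have g_fun: "g \<in> (J' \<rightarrow>\<^sub>E B) \<rightarrow> (I \<rightarrow>\<^sub>E A)"
  proof (rule funcsetI)
    fix x assume "x \<in> J' \<rightarrow>\<^sub>E B"
    then have "g x \<in> f ` (J \<rightarrow>\<^sub>E B)" using g_in img by simp
    then show "g x \<in> I \<rightarrow>\<^sub>E A" using funcset_image[OF f] by (rule subsetD[rotated])
  qed
  \<comment> \<open>Upper bounds on the windows of \<open>g\<close> suffice, since its communication
    complex only has to be contained in \<open>K - {S}\<close>.\<close>
  have W'_in: "input_window B J' g i \<subseteq> (\<lambda>j. 2 * j) ` W i" if "i \<in> C" for i
  proof (rule input_window_least[OF fin'])
    show "(\<lambda>j. 2 * j) ` W i \<subseteq> J'" using W_sub unfolding J'_def by blast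
    fix x y assume x: "x \<in> J' \<rightarrow>\<^sub>E B" and y: "y \<in> J' \<rightarrow>\<^sub>E B"
      and e: "\<And>j. j \<in> (\<lambda>j. 2 * j) ` W i \<Longrightarrow> x j = y j"
    have "f (fst_copy x) i = f (fst_copy y) i"
      by (rule input_window_eqI[OF fin(2) copies(1)[OF x] copies(1)[OF y]])
        (use e in \<open>auto simp: fst_copy_def W_def\<close>)
    then show "g x i = g y i" using that by (simp add: g_def)
  qed
  have W'_out: "input_window B J' g i \<subseteq>
      (\<lambda>j. 2 * j) ` (W i - JS) \<union> (\<lambda>j. 2 * j + 1) ` (W i \<inter> JS)" (is "_ \<subseteq> ?U") if "i \<notin> C" for i
  proof (rule input_window_least[OF fin'])
    show "?U \<subseteq> J'" using W_sub unfolding J'_def by blast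
    fix x y assume x: "x \<in> J' \<rightarrow>\<^sub>E B" and y: "y \<in> J' \<rightarrow>\<^sub>E B"
      and e: "\<And>j. j \<in> ?U \<Longrightarrow> x j = y j"
    have "f (snd_copy x) i = f (snd_copy y) i"
      by (rule input_window_eqI[OF fin(2) copies(2)[OF x] copies(2)[OF y]])
        (use e in \<open>auto simp: snd_copy_def W_def\<close>)
    then show "g x i = g y i" using that by (simp add: g_def)
  qed
  have "communication_complex B J' I g \<subseteq> K - {S}"
  proof
    fix T assume "T \<in> communication_complex B J' I g"
    then obtain k where T: "T \<subseteq> I" and k: "k \<in> J'" "\<And>i. i \<in> T \<Longrightarrow> k \<in> input_window B J' g i"
      unfolding communication_complex_def by blast
    have even_iff: "2 * j \<in> (\<lambda>j. 2 * j) ` X \<longleftrightarrow> j \<in> X"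
        "2 * j \<notin> (\<lambda>j. 2 * j + 1) ` X" for j :: nat and X
      by (auto, presburger)
    have odd_iff: "2 * j + 1 \<in> (\<lambda>j. 2 * j + 1) ` X \<longleftrightarrow> j \<in> X"
        "2 * j + 1 \<notin> (\<lambda>j. 2 * j) ` X" for j :: nat and X
      by (auto, presburger)
    have reads: "k \<in> (\<lambda>j. 2 * j) ` W i" if "i \<in> T" "i \<in> C" for i
      using k(2) W'_in that by blast
    have reads': "k \<in> (\<lambda>j. 2 * j) ` (W i - JS) \<union> (\<lambda>j. 2 * j + 1) ` (W i \<inter> JS)"
      if "i \<in> T" "i \<notin> C" for i
      using k(2) W'_out that by blast
    \<comment> \<open>The parity of the common cell \<open>k\<close> tells which copy of
      \<open>j\<close> it is. For a duplicated cell, the first copy is read only inside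
      \<open>C\<close> and the second only outside.\<close>
    obtain j where j: "j \<in> J" and T_sub: "T \<subseteq> V j"
      and JS: "j \<in> JS \<Longrightarrow> T \<subseteq> C \<or> T \<inter> C = {}"
    proof -
      have "(\<exists>j\<in>J. k = 2 * j) \<or> (\<exists>j\<in>JS. k = 2 * j + 1)"
        using k(1) by (simp add: J'_def image_iff)
      then consider j where "j \<in> J" "k = 2 * j" | j where "j \<in> JS" "k = 2 * j + 1"
        by metis
      then show thesis
      proof cases
        case 1
        have "j \<in> W i \<and> (i \<in> C \<or> j \<notin> JS)" if "i \<in> T" for i
          using reads[OF that] reads'[OF that] by (auto simp only: 1(2) Un_iff even_iff)
        then have "T \<subseteq> V j" "j \<in> JS \<Longrightarrow> T \<subseteq> C"
          using T unfolding V_def by blast+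
        then show thesis using that 1(1) by blast
      next
        case 2
        have "j \<in> W i \<and> i \<notin> C" if "i \<in> T" for i
          using reads[OF that] reads'[OF that] by (auto simp only: 2(2) Un_iff odd_iff)
        then have "T \<subseteq> V j" "T \<inter> C = {}"
          using T unfolding V_def by blast+
        then show thesis using that[of j] 2(1) unfolding JS_def by blast
      qed
    qed
    have "T \<in> K"
      using K V_in[OF j] T_sub unfolding simplicial_complex_on_def by blast
    moreover have "T \<noteq> S"
    proof
      assume "T = S"
      \<comment> \<open>By maximality \<open>j\<close> lies in \<open>JS\<close>, so
        \<open>S\<close> would lie entirely on one side of \<open>C\<close>.\<close>
      then have "V j = S"
        using max V_in[OF j] T_sub unfolding maximal_simplex_def by blast
      then show False
        using JS j \<open>T = S\<close> meets not_sub unfolding JS_def by blast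
    qed
    ultimately show "T \<in> K - {S}" by blast
  qed
  then show ?thesis
    unfolding generates_def
    by (intro exI[of _ B] exI[of _ J'] exI[of _ g] conjI fin(1) fin' g_fun g_img)
qed

section \<open>Monotone binary strings and their recombination\<close>

lemma Mon_extensional: "x \<in> Mon n \<Longrightarrow> x \<in> extensional {..<n}"
  by (simp add: Mon_def PiE_iff)

lemma Mon_01: "x \<in> Mon n \<Longrightarrow> i < n \<Longrightarrow> x i = 0 \<or> x i = 1"
  by (auto simp: Mon_def PiE_iff)

lemma Mon_between:
  assumes "x \<in> Mon n" "p \<le> i" "i \<le> q" "q < n" "x p = x q"
  shows "x i = x p"
proof -
  have "x p \<le> x i \<and> x i \<le> x q \<or> x p \<ge> x i \<and> x i \<ge> x q"
    using assms(1-4) unfolding Mon_def monotone_on_def by auto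
  then show ?thesis using assms(5) by linarith
qed

text \<open>A deviation before \<open>p\<close> would, with only two values available, equal
  \<open>x q\<close>; \<open>Mon_between\<close> would then force \<open>x p\<close> to equal
  \<open>x q\<close> as well. The other side is symmetric.\<close>

lemma Mon_outside:
  assumes "x \<in> Mon n" "p < q" "q < n" "x p \<noteq> x q"
  shows "i \<le> p \<Longrightarrow> x i = x p" and "q \<le> i \<Longrightarrow> i < n \<Longrightarrow> x i = x q"
proof -
  show "x i = x p" if "i \<le> p"
    using Mon_between[OF assms(1), of i p q] Mon_01[OF assms(1), of i] Mon_01[OF assms(1), of p]
      Mon_01[OF assms(1), of q] that assms(2-4) by auto
  show "x i = x q" if "q \<le> i" "i < n"
    using Mon_between[OF assms(1), of p q i] Mon_01[OF assms(1), of i] Mon_01[OF assms(1), of p]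
      Mon_01[OF assms(1), of q] that assms(2-4) by auto
qed

lemma Mon_override_on:
  assumes u: "u \<in> Mon n" and v: "v \<in> Mon n" and pq: "p < q" "q < n"
    and eq: "u p = v p" "u q = v q"
  shows "override_on v u {p<..<q} \<in> Mon n"
proof (cases "u p = u q")
  case True
  have "override_on v u {p<..<q} i = v i" for i
  proof (cases "i \<in> {p<..<q}")
    case inside: True
    then have "u i = u p" "v i = v p"
      using Mon_between[OF u, of p i q] Mon_between[OF v, of p i q] True eq pq by simp_all
    then show ?thesis using inside eq(1) by simp
  qed simp
  then have "override_on v u {p<..<q} = v" by (rule ext)
  then show ?thesis using v by simp
next
  case False
  then have False': "v p \<noteq> v q" using eq by simp
  have "override_on v u {p<..<q} i = u i" for i
  proof (cases "i \<in> {p<..<q}")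
    case outside: False
    then consider "i \<le> p" | "q \<le> i" "i < n" | "i \<ge> n" by force
    then have "v i = u i"
    proof cases
      case 1
      then show ?thesis
        using Mon_outside(1)[OF u pq False, of i] Mon_outside(1)[OF v pq False', of i] eq by simp
    next
      case 2
      then show ?thesis
        using Mon_outside(2)[OF u pq False, of i] Mon_outside(2)[OF v pq False', of i] eq by simp
    next
      case 3
      then show ?thesis
        using Mon_extensional[OF u] Mon_extensional[OF v] by (simp add: extensional_def)
    qed
    then show ?thesis using outside by simp
  qed simp
  then have "override_on v u {p<..<q} = u" by (rule ext)
  then show ?thesis using u by simp
qed

section \<open>Cyclic intervals and the separation of non-intervals\<close>

lemma atLeastAtMost_is_interval_of:
  assumes "m \<le> M" "M < n"
  shows "is_interval_of n {m..M}"
  unfolding is_interval_of_def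
proof (intro exI set_eqI iffI)
  fix i assume "i \<in> {m..M}"
  then show "i \<in> cyclic_interval n (int m) (int M)"
    unfolding cyclic_interval_def using assms
    by (intro CollectI exI[of _ "int i"] exI[of _ "int M"]) auto
next
  fix i assume "i \<in> cyclic_interval n (int m) (int M)"
  then obtain c b' where c: "i = nat (c mod int n)" "[b' = int M] (mod int n)"
    "int m \<le> b'" "b' < int m + int n" "int m \<le> c" "c \<le> b'"
    unfolding cyclic_interval_def by blast
  \<comment> \<open>Both \<open>b'\<close> and \<open>M\<close> lie in \<open>[m, m + n)\<close>,
    which contains one representative of each class.\<close>
  have "int n dvd b' - int M"
    using c(2) by (simp add: cong_iff_dvd_diff)
  moreover have "\<bar>b' - int M\<bar> < int n"
    using c assms by linarith
  ultimately have "b' = int M"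
    using dvd_imp_le_int[of "b' - int M" "int n"] by fastforce
  then show "i \<in> {m..M}"
    using c assms by (simp add: nat_le_iff le_nat_iff)
qed

lemma wrapped_is_interval_of:
  assumes "p \<le> q" "0 < p" "Suc q < n"
  shows "is_interval_of n ({..<p} \<union> {q<..<n})"
  unfolding is_interval_of_def
proof (intro exI set_eqI iffI)
  let ?b = "int p - 1 + int n"
  fix i assume i: "i \<in> {..<p} \<union> {q<..<n}"
  \<comment> \<open>Positions before \<open>p\<close> are shifted by one period, so that the
    representatives run from \<open>q + 1\<close> to \<open>p - 1 + n\<close> without a
    break.\<close>
  define c where "c = (if i < p then int i + int n else int i)"
  have "i = nat (c mod int n)" "int q + 1 \<le> c" "c \<le> ?b"
    using i assms by (auto simp: c_def)
  then show "i \<in> cyclic_interval n (int q + 1) ?b"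
    unfolding cyclic_interval_def using assms
    by (intro CollectI exI[of _ c] exI[of _ ?b]) auto
next
  let ?b = "int p - 1 + int n"
  fix i assume "i \<in> cyclic_interval n (int q + 1) ?b"
  then obtain c b' where c: "i = nat (c mod int n)" "[b' = ?b] (mod int n)"
    "int q + 1 \<le> b'" "b' < int q + 1 + int n" "int q + 1 \<le> c" "c \<le> b'"
    unfolding cyclic_interval_def by blast
  have "int n dvd b' - ?b"
    using c(2) by (simp add: cong_iff_dvd_diff)
  moreover have "\<bar>b' - ?b\<bar> < int n"
    using c assms by linarith
  ultimately have b': "b' = ?b"
    using dvd_imp_le_int[of "b' - ?b" "int n"] by fastforce
  show "i \<in> {..<p} \<union> {q<..<n}"
  proof (cases "c < int n")
    case True
    then show ?thesis using c assms by auto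
  next
    case False
    then have "c mod int n = (c - int n) mod int n" by simp
    also have "\<dots> = c - int n"
      using False b' c assms by (intro mod_pos_pos_trivial) linarith+
    finally show ?thesis using False b' c assms by auto
  qed
qed

text \<open>Without a separating pair, the first and last gaps of \<open>S\<close> between its
  extreme elements bound a single block of gaps, and \<open>S\<close> must reach both
  \<open>0\<close> and \<open>n - 1\<close>. Then \<open>S\<close> is a wrapped interval.\<close>

lemma non_interval_separated:
  assumes "S \<subseteq> {..<n}" "S \<noteq> {}" "\<not> is_interval_of n S"
  obtains p q where "p < q" "q < n" "p \<notin> S" "q \<notin> S" "S \<inter> {p<..<q} \<noteq> {}" "\<not> S \<subseteq> {p<..<q}"
proof (rule ccontr)
  assume neg: "\<not> thesis"
  note separated = that
  have sep: "S \<inter> {p<..<q} = {} \<or> S \<subseteq> {p<..<q}" if "p < q" "q < n" "p \<notin> S" "q \<notin> S" for p q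
    using neg separated[OF that] by blast
  have fin: "finite S" using assms(1) finite_subset by blast
  define m M where "m = Min S" and "M = Max S"
  have mM: "m \<in> S" "M \<in> S" "S \<subseteq> {m..M}"
    using fin assms(2) by (auto simp: m_def M_def)
  have Mn: "M < n" using mM(2) assms(1) by blast
  have le: "m \<le> M" using mM by auto
  define G where "G = {m..M} - S"
  have "G \<noteq> {}"
    using assms(3) atLeastAtMost_is_interval_of[OF le Mn] mM(3) unfolding G_def by force
  moreover have "finite G" by (simp add: G_def)
  ultimately obtain p q where p: "p \<in> G" "\<And>k. k \<in> G \<Longrightarrow> p \<le> k"
    and q: "q \<in> G" "\<And>k. k \<in> G \<Longrightarrow> k \<le> q"
    using Min_in Min_le Max_in Max_ge by metis
  have pq: "m < p" "p \<le> q" "q < M" "p \<notin> S" "q \<notin> S"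
    using p q mM unfolding G_def by (auto simp: order_less_le)
  have gap: "S \<inter> {p..q} = {}"
  proof (cases "p = q")
    case True
    then show ?thesis using pq by auto
  next
    case False
    \<comment> \<open>The alternative \<open>S \<subseteq> {p<..<q}\<close> fails because
      \<open>m\<close> lies in \<open>S\<close> and below \<open>p\<close>.\<close>
    then have "S \<inter> {p<..<q} = {}"
      using sep[of p q] pq Mn mM(1) by fastforce
    then show ?thesis using pq(4,5) by (auto simp: order_less_le)
  qed
  have "m = 0"
  proof (rule ccontr)
    assume "m \<noteq> 0"
    then have "0 \<notin> S" using mM(3) by auto
    \<comment> \<open>The pair \<open>0\<close>, \<open>p\<close> would separate \<open>S\<close>,
      with \<open>m\<close> between them and \<open>M\<close> beyond. The pair \<open>q\<close>,
      \<open>n - 1\<close> serves likewise for the upper end.\<close>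
    then show False
      using sep[of 0 p] pq mM(1,2) Mn \<open>m \<noteq> 0\<close> by fastforce
  qed
  have "M = n - 1"
  proof (rule ccontr)
    assume "M \<noteq> n - 1"
    then have "M < n - 1" using Mn by linarith
    moreover from this have "n - 1 \<notin> S" using mM(3) by auto
    ultimately show False
      using sep[of q "n - 1"] pq mM(1,2) by fastforce
  qed
  have "S = {..<p} \<union> {q<..<n}"
  proof
    show "S \<subseteq> {..<p} \<union> {q<..<n}"
      using gap assms(1) by force
    show "{..<p} \<union> {q<..<n} \<subseteq> S"
    proof
      fix k assume k: "k \<in> {..<p} \<union> {q<..<n}"
      then have "k \<in> {m..M}"
        using pq Mn by (auto simp: \<open>m = 0\<close> \<open>M = n - 1\<close>)
      moreover have "k \<notin> G"
        using k p(2)[of k] q(2)[of k] pq(2) by auto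
      ultimately show "k \<in> S" by (simp add: G_def)
    qed
  qed
  then show False
    using wrapped_is_interval_of[of p q n] pq Mn assms(3) by simp
qed

section \<open>Vertices of a generating complex, and the conclusion\<close>

lemma constants_in_Mon:
  assumes "c = 0 \<or> c = 1"
  shows "(\<lambda>i\<in>{..<n}. c) \<in> Mon n"
  using assms by (auto simp: Mon_def monotone_on_def)

text \<open>The two constant strings make every coordinate of \<open>f\<close> nonconstant, so its
  window is nonempty. This excludes the empty set as a maximal simplex.\<close>

lemma generates_Mon_vertex:
  assumes "generates A {..<n} K (Mon n)" "i < n"
  shows "{i} \<in> K"
proof -
  obtain B J :: "nat set" and f where J: "finite J"
    and img: "f ` (J \<rightarrow>\<^sub>E B) = Mon n" and sub: "communication_complex B J {..<n} f \<subseteq> K"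
    using assms(1) unfolding generates_def by blast
  have "(\<lambda>i\<in>{..<n}. 0) \<in> f ` (J \<rightarrow>\<^sub>E B)" "(\<lambda>i\<in>{..<n}. 1) \<in> f ` (J \<rightarrow>\<^sub>E B)"
    unfolding img by (simp_all add: constants_in_Mon)
  then obtain x y where xy: "x \<in> J \<rightarrow>\<^sub>E B" "y \<in> J \<rightarrow>\<^sub>E B"
    and "(\<lambda>i\<in>{..<n}. 0) = f x" "(\<lambda>i\<in>{..<n}. 1) = f y"
    by (elim imageE) (rule that)
  then have "f x i = 0" "f y i = 1"
    using assms(2) by (metis lessThan_iff restrict_apply')+
  then have "f x i \<noteq> f y i" by simp
  then obtain j where "j \<in> input_window B J f i"
    using input_window_eqI[OF J xy, of f i] by blast
  then have "{i} \<in> communication_complex B J {..<n} f"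
    using assms(2) input_window_subset[OF J, of B f i] unfolding communication_complex_def by auto
  then show ?thesis using sub by blast
qed

theorem theorem4p3:
  fixes n :: nat and K :: "nat set set"
  assumes "n \<ge> 1"
    and "minimal_generating {0, 1 :: nat} {..<n} K (Mon n)"
  shows "\<forall>S. maximal_simplex K S \<longrightarrow> is_interval_of n S"
proof (intro allI impI, rule ccontr)
  fix S assume max: "maximal_simplex K S" and ni: "\<not> is_interval_of n S"
  have K: "simplicial_complex_on {..<n} K" and gen: "generates {0, 1} {..<n} K (Mon n)"
    and minimal: "\<And>K'. simplicial_complex_on {..<n} K' \<Longrightarrow> K' \<subset> K
      \<Longrightarrow> \<not> generates {0, 1} {..<n} K' (Mon n)"
    using assms(2) unfolding minimal_generating_def by blast+
  have SK: "S \<in> K" using max by (simp add: maximal_simplex_def)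
  have "S \<subseteq> {..<n}" using K SK by (simp add: simplicial_complex_on_def)
  moreover have "S \<noteq> {}"
    using generates_Mon_vertex[OF gen, of 0] assms(1) max unfolding maximal_simplex_def by auto
  ultimately obtain p q where pq: "p < q" "q < n" "p \<notin> S" "q \<notin> S"
    and "S \<inter> {p<..<q} \<noteq> {}" "\<not> S \<subseteq> {p<..<q}"
    using non_interval_separated ni by blast
  \<comment> \<open>Here \<open>C\<close> is \<open>{p<..<q}\<close>. Strings agreeing off
    \<open>S\<close> agree at \<open>p\<close> and \<open>q\<close>, so
    \<open>Mon_override_on\<close> provides the mixing hypothesis.\<close>
  then have "generates {0, 1} {..<n} (K - {S}) (Mon n)"
    by (intro generates_remove_maximal[OF K gen max]) (auto intro!: Mon_override_on)
  then show False
    using minimal simplicial_complex_on_remove_maximal[OF K max] SK by blast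
qed

end
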